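(* Let $k\ge 3$ and let $n_1,\dots,n_k$ be positive integers with $n_1=\max\{n_i : i\in[1,k]\}$ and $n_1\ge \sum_{i=2}^k n_i$. Let $G=K_{n_1,n_2,\dots,n_k}$ be the complete $k$-partite graph with partite sets $V_1,\dots,V_k$, $|V_i|=n_i$. Let $H$ be the subgraph of $G$ induced by $\bigcup_{i=2}^k V_i$, let $H'$ be any subgraph of $H$, and let $G'$ be the graph with $V(G')=V(G)$ and $E(G')=E(G)\setminus E(H')$. Then $\mathrm{str}(G')=\mathrm{str}(G)$.
   Context: Graphs are finite, without loops or multiple edges. For integers $a\le b$, $[a,b]$ denotes $\{x\in\mathbb{Z}: a\le x\le b\}$. A numbering of a graph $G$ of order $n$ is a bijection $f:V(G)\to[1,n]$. For a numbering $f$, $\mathrm{str}_f(G)=\max\{f(u)+f(v): uv\in E(G)\}$, and the strength of $G$ is $\mathrm{str}(G)=\min\{\mathrm{str}_f(G): f \text{ a numbering of } G\}$ (with $\mathrm{str}(G)=+\infty$ if $G$ has no edges). *)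

theory Defs
  imports
    "HOL-Library.Disjoint_Sets"
    "HOL-Library.Extended_Nat"
    "Graph_Theory.Digraph_Component"
begin

text \<open>
  Finite simple graphs are the library's \<^locale>\<open>graph\<close>: an undirected edge \<open>uv\<close> is represented by
  a pair of arcs with ends \<open>(u, v)\<close> and \<open>(v, u)\<close>.
\<close>

definition numbering :: "('a, 'b) pre_digraph \<Rightarrow> ('a \<Rightarrow> nat) \<Rightarrow> bool" where
  "numbering G f \<longleftrightarrow> bij_betw f (verts G) {1..card (verts G)}"

text \<open>Only meaningful for graphs with at least one edge.\<close>

definition strength_of :: "('a, 'b) pre_digraph \<Rightarrow> ('a \<Rightarrow> nat) \<Rightarrow> nat" where
  "strength_of G f = Max {f u + f v | u v. (u, v) \<in> arcs_ends G}"

definition strength :: "('a, 'b) pre_digraph \<Rightarrow> enat" where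
  "strength G = (if arcs G = {} then \<infinity> else enat (Min {strength_of G f | f. numbering G f}))"

text \<open>
  \<open>G\<close> is the complete \<open>k\<close>-partite graph with partite sets \<open>V 1, \<dots>, V k\<close> of sizes \<open>n 1, \<dots>, n k\<close>.
\<close>

definition complete_multipartite ::
    "nat \<Rightarrow> (nat \<Rightarrow> nat) \<Rightarrow> (nat \<Rightarrow> 'a set) \<Rightarrow> ('a, 'b) pre_digraph \<Rightarrow> bool" where
  "complete_multipartite k n V G \<longleftrightarrow> graph G
    \<and> disjoint_family_on V {1..k}
    \<and> verts G = (\<Union>i\<in>{1..k}. V i)
    \<and> (\<forall>i\<in>{1..k}. card (V i) = n i)
    \<and> arcs_ends G = {(u, v). \<exists>i\<in>{1..k}. \<exists>j\<in>{1..k}. i \<noteq> j \<and> u \<in> V i \<and> v \<in> V j}"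

text \<open>The sets under \<open>Max\<close> and \<open>Min\<close> above are finite and nonempty for a graph with an edge.\<close>

lemma (in graph) finite_edge_sums: "finite {f u + f v | u v. (u, v) \<in> arcs_ends G}"
proof -
  have "{f u + f v | u v. (u, v) \<in> arcs_ends G} = (\<lambda>(u, v). f u + f v) ` arcs_ends G"
    by auto
  then show ?thesis by (simp add: arcs_ends_def)
qed

lemma edge_sums_nonempty:
  "arcs G \<noteq> {} \<Longrightarrow> {f u + f v | u v. (u, v) \<in> arcs_ends G} \<noteq> {}"
  by (auto simp: arcs_ends_conv)

lemma (in graph) finite_strengths:
  assumes "arcs G \<noteq> {}"
  shows "finite {strength_of G f | f. numbering G f}"
proof (rule finite_subset)
  show "{strength_of G f | f. numbering G f} \<subseteq> {..2 * card (verts G)}"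
  proof
    fix s assume "s \<in> {strength_of G f | f. numbering G f}"
    then obtain f where s: "s = strength_of G f" and "numbering G f" by blast
    then have le: "f w \<le> card (verts G)" if "w \<in> verts G" for w
      using that by (auto simp: numbering_def bij_betw_def)
    have "f u + f v \<le> 2 * card (verts G)" if "(u, v) \<in> arcs_ends G" for u v
    proof -
      have "u \<in> verts G" "v \<in> verts G" using that by (auto simp: arcs_ends_conv)
      from le[OF this(1)] le[OF this(2)] show ?thesis by linarith
    qed
    then show "s \<in> {..2 * card (verts G)}"
      unfolding s strength_of_def
      using finite_edge_sums[of f] edge_sums_nonempty[OF assms, of f] by auto
  qed
qed simp

lemma (in graph) strengths_nonempty: "{strength_of G f | f. numbering G f} \<noteq> {}"
proof -
  have "\<exists>f. bij_betw f (verts G) {1..card (verts G)}"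
    by (rule finite_same_card_bij) auto
  then show ?thesis by (auto simp: numbering_def)
qed

end

theory Submission
  imports Defs
begin

text \<open>
  Let \<open>B\<close> be the union of the small parts, \<open>m = |B|\<close>, and \<open>N\<close> the number of vertices. Any graph that
  contains all edges between \<open>V 1\<close> and \<open>B\<close> and none inside \<open>V 1\<close> has strength \<open>N + m\<close>, whatever
  its edges inside \<open>B\<close> are. Numbering \<open>B\<close> by \<open>1, \<dots>, m\<close> attains this value. Conversely, the vertex
  numbered \<open>N\<close> lies in one of the two sides, and the largest number on the other side is at least
  the size of that side, hence at least \<open>m\<close>.
\<close>

text \<open>The \<open>card S\<close> distinct values of \<open>f\<close> all lie between 1 and
  their maximum, so that maximum is at least \<open>card S\<close>. It is attained because
  \<open>S\<close> is finite and nonempty.\<close>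

lemma exists_card_le_value:
  fixes f :: "'a \<Rightarrow> nat"
  assumes "finite S" "S \<noteq> {}" "inj_on f S" "\<And>x. x \<in> S \<Longrightarrow> 1 \<le> f x"
  shows "\<exists>x\<in>S. card S \<le> f x"
proof -
  have "card S = card (f ` S)" using assms(3) by (simp add: card_image)
  also have "\<dots> \<le> card {1..Max (f ` S)}"
    using assms by (intro card_mono) auto
  finally have "card S \<le> Max (f ` S)" by simp
  moreover have "Max (f ` S) \<in> f ` S" using assms by (intro Max_in) auto
  ultimately show ?thesis by auto
qed

context fin_digraph
begin

text \<open>Proved at the level of \<open>fin_digraph\<close>, since the graph with arcs removed is
  interpreted only as a finite digraph below.\<close>

lemma finite_arc_sums: "finite {f u + f v | u v. (u, v) \<in> arcs_ends G}"
proof -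
  have "{f u + f v | u v. (u, v) \<in> arcs_ends G} = (\<lambda>(u, v). f u + f v) ` arcs_ends G"
    by auto
  then show ?thesis by (simp add: arcs_ends_def)
qed

lemma le_strength_of: "(u, v) \<in> arcs_ends G \<Longrightarrow> f u + f v \<le> strength_of G f"
  unfolding strength_of_def by (rule Max_ge[OF finite_arc_sums]) blast

lemma strength_of_le:
  assumes "arcs G \<noteq> {}" "\<And>u v. (u, v) \<in> arcs_ends G \<Longrightarrow> f u + f v \<le> s"
  shows "strength_of G f \<le> s"
  unfolding strength_of_def
  by (rule Max.boundedI[OF finite_arc_sums edge_sums_nonempty[OF assms(1)]]) (auto dest: assms(2))

text \<open>\<open>Min\<close> needs a finite set: vertex numbers are at most the order, so every
  strength is at most twice the order. The numbering \<open>g\<close> shows that the lower bound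
  \<open>s\<close> is attained.\<close>

lemma strength_eqI:
  assumes "arcs G \<noteq> {}"
    and lower: "\<And>f. numbering G f \<Longrightarrow> s \<le> strength_of G f"
    and g: "numbering G g" "strength_of G g \<le> s"
  shows "strength G = enat s"
proof -
  let ?S = "{strength_of G f | f. numbering G f}"
  have "strength_of G f \<le> 2 * card (verts G)" if f: "numbering G f" for f
  proof (rule strength_of_le[OF assms(1)])
    fix u v assume uv: "(u, v) \<in> arcs_ends G"
    have "f w \<le> card (verts G)" if "w \<in> verts G" for w
      using f that by (auto simp: numbering_def bij_betw_def)
    moreover have "u \<in> verts G" "v \<in> verts G" using uv by (auto simp: arcs_ends_conv)
    ultimately show "f u + f v \<le> 2 * card (verts G)"
      by (metis add_mono mult_2)
  qed
  then have "finite ?S" by (intro finite_subset[of ?S "{..2 * card (verts G)}"]) auto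
  moreover have "strength_of G g = s" using lower g by (simp add: antisym)
  ultimately have "Min ?S = s"
    using lower g(1) by (intro Min_eqI) auto
  then show ?thesis using assms(1) by (simp add: strength_def)
qed

text \<open>The value depends only on the order and on \<open>card B\<close>, and arcs inside
  \<open>B\<close> are left free, so one formula covers the graph before and after the deletion.
  Symmetry is a premise because \<open>fin_digraph\<close> does not provide it.\<close>

lemma strength_eq_card_verts_plus_card_part:
  assumes part: "verts G = A \<union> B" "A \<inter> B = {}"
    and "B \<noteq> {}" and le: "card B \<le> card A"
    and sym: "sym (arcs_ends G)"
    and across: "A \<times> B \<subseteq> arcs_ends G"
    and inside: "arcs_ends G \<inter> A \<times> A = {}"
  shows "strength G = enat (card (verts G) + card B)"
proof -
  let ?N = "card (verts G)"
  have fin: "finite A" "finite B" using finite_verts part by simp_all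
  then have N: "?N = card A + card B" using part by (simp add: card_Un_disjoint)
  have "card B > 0" using fin \<open>B \<noteq> {}\<close> by (simp add: card_gt_0_iff)
  then have "A \<noteq> {}" using le by auto
  have arcs: "arcs G \<noteq> {}"
    using across \<open>A \<noteq> {}\<close> \<open>B \<noteq> {}\<close> by (auto simp: arcs_ends_def)
  \<comment> \<open>Here \<open>x\<close> carries the largest number and \<open>S\<close> is the
    side opposite to it, all of whose vertices are neighbours of \<open>x\<close>.\<close>
  have bound: "?N + card B \<le> strength_of G f"
    if S: "finite S" "S \<noteq> {}" "card B \<le> card S" "S \<subseteq> verts G" "{x} \<times> S \<subseteq> arcs_ends G"
      and f: "numbering G f" "f x = ?N" for f x S
  proof -
    have "inj_on f (verts G)" "\<And>y. y \<in> verts G \<Longrightarrow> 1 \<le> f y"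
      using f(1) by (auto simp: numbering_def bij_betw_def)
    then obtain y where "y \<in> S" "card S \<le> f y"
      using exists_card_le_value[of S f] S by (meson inj_on_subset subsetD)
    moreover have "f x + f y \<le> strength_of G f"
      using S(5) \<open>y \<in> S\<close> by (intro le_strength_of) auto
    ultimately show ?thesis using S(3) f(2) by linarith
  qed
  \<comment> \<open>Optimal numbering: \<open>B\<close> receives the smallest numbers and
    \<open>A\<close> all the remaining ones.\<close>
  have "card A = card {card B + 1..?N}" using N by simp
  then obtain a where a: "bij_betw a A {card B + 1..?N}"
    using finite_same_card_bij[OF fin(1) finite_atLeastAtMost] by blast
  have "card B = card {1..card B}" by simp
  then obtain b where b: "bij_betw b B {1..card B}"
    using finite_same_card_bij[OF fin(2) finite_atLeastAtMost] by blast
  define g where "g x = (if x \<in> B then b x else a x)" for x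
  have gA: "bij_betw g A {card B + 1..?N}"
    using a part(2) by (subst bij_betw_cong[where g = a]) (auto simp: g_def)
  have gB: "bij_betw g B {1..card B}"
    using b by (subst bij_betw_cong[where g = b]) (auto simp: g_def)
  have "bij_betw g (A \<union> B) ({card B + 1..?N} \<union> {1..card B})"
    using gA gB by (rule bij_betw_combine) auto
  moreover have "{card B + 1..?N} \<union> {1..card B} = {1..?N}" using N by auto
  ultimately have g: "numbering G g" by (simp add: numbering_def part(1))
  show ?thesis
  proof (rule strength_eqI[OF arcs _ g])
    fix f assume f: "numbering G f"
    have "?N \<in> f ` verts G"
      using f N \<open>card B > 0\<close> by (auto simp: numbering_def bij_betw_def)
    then obtain x where x: "x \<in> verts G" "f x = ?N" by auto
    then consider "x \<in> A" | "x \<in> B" using part(1) by auto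
    then show "?N + card B \<le> strength_of G f"
    proof cases
      case 1
      with across show ?thesis
        using part(1) fin \<open>B \<noteq> {}\<close> f x by (intro bound[of B x]) auto
    next
      case 2
      \<comment> \<open>\<open>across\<close> only lists arcs from \<open>A\<close> to
        \<open>B\<close>; symmetry reverses them.\<close>
      with across have "{x} \<times> A \<subseteq> arcs_ends G" using sym by (auto dest: symD)
      then show ?thesis
        using part(1) fin \<open>A \<noteq> {}\<close> f x le by (intro bound[of A x]) auto
    qed
  next
    show "strength_of G g \<le> ?N + card B"
    proof (rule strength_of_le[OF arcs])
      fix u v assume uv: "(u, v) \<in> arcs_ends G"
      then have V: "u \<in> verts G" "v \<in> verts G" by (auto simp: arcs_ends_conv)
      have B: "g w \<le> card B" if "w \<in> B" for w
        using gB that by (auto simp: bij_betw_def)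
      have AB: "g w \<le> ?N" if "w \<in> verts G" for w
        using g that by (auto simp: numbering_def bij_betw_def)
      \<comment> \<open>An end in \<open>B\<close> contributes at most \<open>card B\<close>, the
        other end at most \<open>?N\<close>.\<close>
      have "u \<in> B \<or> v \<in> B" using uv inside V unfolding part(1) by blast
      then show "g u + g v \<le> ?N + card B"
        using B[of u] B[of v] AB[OF V(1)] AB[OF V(2)] by linarith
    qed
  qed
qed

end

theorem theorem2p5:
  fixes G H H' G' :: "('a, 'b) pre_digraph"
    and V :: "nat \<Rightarrow> 'a set" and n :: "nat \<Rightarrow> nat" and k :: nat
  assumes "k \<ge> 3"
    and "\<forall>i\<in>{1..k}. n i > 0"
    and "n 1 = Max (n ` {1..k})"
    and "n 1 \<ge> (\<Sum>i=2..k. n i)"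
    and "complete_multipartite k n V G"
    and "H = G \<restriction> (\<Union>i\<in>{2..k}. V i)"
    and "graph H'" and "subgraph H' H"
    and "G' = G\<lparr>arcs := arcs G - arcs H'\<rparr>"
  shows "strength G' = strength G"
proof -
  interpret graph G using assms(5) by (simp add: complete_multipartite_def)
  interpret H': graph H' by fact
  define B where "B = (\<Union>i\<in>{2..k}. V i)"
  have disj: "disjoint_family_on V {1..k}"
    and verts: "verts G = (\<Union>i\<in>{1..k}. V i)"
    and card: "\<And>i. i \<in> {1..k} \<Longrightarrow> card (V i) = n i"
    and ends: "arcs_ends G = {(u, v). \<exists>i\<in>{1..k}. \<exists>j\<in>{1..k}. i \<noteq> j \<and> u \<in> V i \<and> v \<in> V j}"
    using assms(5) by (simp_all add: complete_multipartite_def)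
  have split: "{1..k} = insert 1 {2..k}" using assms(1) by auto
  have part: "verts G = V 1 \<union> B" unfolding verts B_def split by simp
  have V1: "V 1 \<inter> V i = {}" if "i \<in> {1..k}" "i \<noteq> 1" for i
    using disjoint_family_onD[OF disj, of 1 i] that assms(1) by simp
  have VB: "V 1 \<inter> B = {}"
  proof -
    have "V 1 \<inter> V i = {}" if "i \<in> {2..k}" for i using that by (intro V1) auto
    then show ?thesis unfolding B_def by blast
  qed
  have "card (V 2) > 0" using card[of 2] assms(1,2) by simp
  then have "V 2 \<noteq> {}" by auto
  moreover have "V 2 \<subseteq> B" unfolding B_def using assms(1) by (intro UN_upper) simp
  ultimately have "B \<noteq> {}" by blast
  have "card B \<le> (\<Sum>i=2..k. card (V i))" unfolding B_def by (rule card_UN_le) simp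
  also have "\<dots> = (\<Sum>i=2..k. n i)" by (intro sum.cong) (auto simp: card)
  also have "\<dots> \<le> card (V 1)" using assms(1,4) card[of 1] by simp
  finally have le: "card B \<le> card (V 1)" .
  have symG: "sym (arcs_ends G)" using sym_arcs by (simp add: symmetric_def)
  have across: "V 1 \<times> B \<subseteq> arcs_ends G"
  proof clarify
    fix u v assume "u \<in> V 1" "v \<in> B"
    then obtain j where "j \<in> {2..k}" "v \<in> V j" unfolding B_def by blast
    then have "1 \<in> {1..k}" "j \<in> {1..k}" "1 \<noteq> j" by auto
    then show "(u, v) \<in> arcs_ends G"
      unfolding ends using \<open>u \<in> V 1\<close> \<open>v \<in> V j\<close> by blast
  qed
  have inside: "arcs_ends G \<inter> V 1 \<times> V 1 = {}"
  proof -
    have "i = 1" if "u \<in> V 1" "u \<in> V i" "i \<in> {1..k}" for u i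
      using V1 that by blast
    then show ?thesis unfolding ends by blast
  qed
  \<comment> \<open>An induced subgraph keeps only the arcs with both ends in the chosen vertex set,
    so every deleted arc lies inside \<open>B\<close>.\<close>
  have arcsH': "arcs H' \<subseteq> {e \<in> arcs G. tail G e \<in> B \<and> head G e \<in> B}"
    using assms(8) by (auto simp: assms(6) B_def subgraph_def induce_subgraph_def)
  have compat: "tail H' = tail G" "head H' = head G"
    using assms(8) by (auto simp: assms(6) subgraph_def compatible_def)
  have vG': "verts G' = verts G" and tG': "tail G' = tail G" "head G' = head G"
    and aG': "arcs G' = arcs G - arcs H'"
    by (simp_all add: assms(9))
  interpret G': fin_digraph G'
    by unfold_locales (auto simp: vG' tG' aG')
  have ends': "arcs_ends G' = arcs_ends G - arcs_ends H'"
  proof -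
    \<comment> \<open>Without parallel arcs in \<open>G\<close>, a surviving arc cannot share both
      ends with a deleted one, so deleting arcs amounts to deleting their end pairs.\<close>
    have "e = e'" if "e \<in> arcs G" "e' \<in> arcs H'" "tail G e = tail G e'" "head G e = head G e'" for e e'
      using that arcsH' by (intro no_multi_arcs) (auto simp: arc_to_ends_def)
    then have "(tail G e, head G e) \<notin> arcs_ends H'" if "e \<in> arcs G - arcs H'" for e
      using that by (fastforce simp: arcs_ends_conv compat)
    then show ?thesis
      by (fastforce simp: arcs_ends_conv tG' aG' compat)
  qed
  have "arcs_ends H' \<subseteq> B \<times> B" using arcsH' by (auto simp: arcs_ends_conv compat)
  then have across': "V 1 \<times> B \<subseteq> arcs_ends G'" using across VB unfolding ends' by blast
  have inside': "arcs_ends G' \<inter> V 1 \<times> V 1 = {}" using inside unfolding ends' by blast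
  \<comment> \<open>As \<open>H'\<close> is itself undirected, both orientations of an edge are
    deleted together.\<close>
  have "sym (arcs_ends H')" using H'.sym_arcs by (simp add: symmetric_def)
  then have symG': "sym (arcs_ends G')" using symG unfolding ends' by (auto intro!: symI dest: symD)
  show ?thesis
    using strength_eq_card_verts_plus_card_part[OF part VB \<open>B \<noteq> {}\<close> le symG across inside]
      G'.strength_eq_card_verts_plus_card_part
        [OF _ VB \<open>B \<noteq> {}\<close> le symG' across' inside', unfolded vG', OF part]
    by simp
qed

end
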